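(* Define $$\mathcal F_{HS}:=\{(v,\mathbf E)\in[0,1]\times\mathbb S^{2\times2\times2\times2}:\mathbf E\in\mathcal A^{(2)}(v)\},\qquad\mathcal F_V:=\{(v,\mathbf E)\in[0,1]\times\mathbb S^{2\times2\times2\times2}:\mathbf E\in\mathcal A^{(1)}(v)\}.$$ Then, with the convex hull taken in the product space with coordinates $(v,\mathbf E)$, $\mathrm{Conv}(\mathcal F_{HS})=\mathcal F_V$.
   Context: $\mathbb S^{2\times2}$ is the space of real symmetric $2\times2$ matrices with the Frobenius inner product; $\mathbb S^{2\times2\times2\times2}$ is the space of fourth-order tensors acting as self-adjoint linear maps on $\mathbb S^{2\times2}$; $\preceq$ is the Loewner order. $\mathbf E^\pm\varepsilon=\kappa^\pm\mathrm{Tr}(\varepsilon)I+2\mu^\pm(\varepsilon-\tfrac12\mathrm{Tr}(\varepsilon)I)$ with $0<\kappa^-<\kappa^+$, $0<\mu^-<\mu^+$; $\Delta\kappa=\kappa^+-\kappa^-$, $\Delta\mu=\mu^+-\mu^-$. Voigt set: $\mathcal A^{(1)}(v)=\{\mathbf E:\mathbf E^-\preceq\mathbf E\preceq(1-v)\mathbf E^-+v\mathbf E^+\}$. Hashin--Shtrikman set: $\mathcal A^{(2)}(v)=\{\mathbf E:\mathbf E^-\preceq\mathbf E,\ \langle\mathbf E\varepsilon,\varepsilon\rangle\le f^{HS}(\varepsilon;v)\ \forall\varepsilon\in\mathbb S^{2\times2}\}$, where $f^{HS}(\varepsilon;v)=\langle[(1-v)\mathbf E^-+v\mathbf E^+]\varepsilon,\varepsilon\rangle-q(\varepsilon;v)$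 and, with $t=|\mathrm{Tr}(\varepsilon)|$, $s=\sqrt{\mathrm{Tr}(\varepsilon)^2-4\det\varepsilon}$, $q=\dfrac{v(1-v)(\Delta\kappa\,t-\Delta\mu\,s)^2}{\kappa^++\mu^+-(\Delta\kappa+\Delta\mu)v}$ if $v t\Delta\kappa\le(\kappa^++\mu^+-\Delta\kappa v)s$ and $v s\Delta\mu\le(\kappa^++\mu^+-\Delta\mu v)t$; $q=(1-v)\Big[\dfrac{v t^2\Delta\kappa^2}{\kappa^++\mu^+-\Delta\kappa v}-s^2\Delta\mu\Big]$ if $v t\Delta\kappa>(\kappa^++\mu^+-\Delta\kappa v)s$; $q=(1-v)\Big[\dfrac{v s^2\Delta\mu^2}{\kappa^++\mu^+-\Delta\mu v}-t^2\Delta\kappa\Big]$ if $v s\Delta\mu>(\kappa^++\mu^+-\Delta\mu v)t$. *)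

theory Defs
  imports "HOL-Analysis.Analysis"
begin

typedef sym2 = "{A :: real^2^2. transpose A = A}"
  morphisms mat_of_sym2 Abs_sym2
  by (rule exI[of _ "mat 1"]) (simp add: transpose_mat)

setup_lifting type_definition_sym2

instantiation sym2 :: real_inner
begin

lift_definition zero_sym2 :: sym2 is "0"
  by (simp add: transpose_def vec_eq_iff)

lift_definition plus_sym2 :: "sym2 \<Rightarrow> sym2 \<Rightarrow> sym2" is "(+)"
  by (simp add: transpose_def vec_eq_iff)

lift_definition minus_sym2 :: "sym2 \<Rightarrow> sym2 \<Rightarrow> sym2" is "(-)"
  by (simp add: transpose_def vec_eq_iff)

lift_definition uminus_sym2 :: "sym2 \<Rightarrow> sym2" is "uminus"
  by (simp add: transpose_def vec_eq_iff)

lift_definition scaleR_sym2 :: "real \<Rightarrow> sym2 \<Rightarrow> sym2" is "scaleR"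
  by (simp add: transpose_def vec_eq_iff)

text \<open>On \<open>real^2^2\<close> the library's inner product is the Frobenius one,
  \<open>\<Sum>i j. A $ i $ j * B $ i $ j\<close>.\<close>

lift_definition inner_sym2 :: "sym2 \<Rightarrow> sym2 \<Rightarrow> real" is "inner" .

definition norm_sym2 :: "sym2 \<Rightarrow> real"
  where "norm_sym2 x = sqrt (x \<bullet> x)"

definition dist_sym2 :: "sym2 \<Rightarrow> sym2 \<Rightarrow> real"
  where "dist_sym2 x y = norm (x - y)"

definition sgn_sym2 :: "sym2 \<Rightarrow> sym2"
  where "sgn_sym2 x = inverse (norm x) *\<^sub>R x"

definition uniformity_sym2 :: "(sym2 \<times> sym2) filter"
  where "uniformity_sym2 = (INF e\<in>{0<..}. principal {(x, y). dist x y < e})"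

definition open_sym2 :: "sym2 set \<Rightarrow> bool"
  where "open_sym2 U = (\<forall>x\<in>U. \<forall>\<^sub>F (x', y) in uniformity. x' = x \<longrightarrow> y \<in> U)"

instance
proof
  fix x y z :: sym2 and a b :: real and U :: "sym2 set"
  show "x + y + z = x + (y + z)" by transfer simp
  show "x + y = y + x" by transfer simp
  show "0 + x = x" by transfer simp
  show "- x + x = 0" by transfer simp
  show "x - y = x + - y" by transfer simp
  show "a *\<^sub>R (x + y) = a *\<^sub>R x + a *\<^sub>R y" by transfer (rule scaleR_right_distrib)
  show "(a + b) *\<^sub>R x = a *\<^sub>R x + b *\<^sub>R x" by transfer (rule scaleR_left_distrib)
  show "a *\<^sub>R b *\<^sub>R x = (a * b) *\<^sub>R x" by transfer simp
  show "1 *\<^sub>R x = x" by transfer simp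
  show "x \<bullet> y = y \<bullet> x" by transfer (rule inner_commute)
  show "(x + y) \<bullet> z = x \<bullet> z + y \<bullet> z" by transfer (rule inner_add_left)
  show "(a *\<^sub>R x) \<bullet> y = a * (x \<bullet> y)" by transfer simp
  show "0 \<le> x \<bullet> x" by transfer simp
  show "(x \<bullet> x = 0) = (x = 0)" by transfer simp
  show "norm x = sqrt (x \<bullet> x)" by (rule norm_sym2_def)
  show "dist x y = norm (x - y)" by (rule dist_sym2_def)
  show "sgn x = inverse (norm x) *\<^sub>R x" by (rule sgn_sym2_def)
  show "(uniformity :: (sym2 \<times> sym2) filter) = (INF e\<in>{0<..}. principal {(x, y). dist x y < e})"
    by (rule uniformity_sym2_def)
  show "open U = (\<forall>x\<in>U. \<forall>\<^sub>F (x', y) in uniformity. x' = x \<longrightarrow> y \<in> U)"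
    by (rule open_sym2_def)
qed

end

lemma norm_mat_of_sym2: "norm (mat_of_sym2 e) = norm e"
  by (simp add: norm_eq_sqrt_inner inner_sym2.rep_eq)

lift_definition id_sym2 :: sym2 is "mat 1"
  by (simp add: transpose_mat)

lift_definition tr_sym2 :: "sym2 \<Rightarrow> real" is trace .

lift_definition det_sym2 :: "sym2 \<Rightarrow> real" is det .

lemma bounded_linear_tr_sym2: "bounded_linear tr_sym2"
proof -
  have "bounded_linear (trace :: real^2^2 \<Rightarrow> real)"
    unfolding linear_conv_bounded_linear[symmetric]
    by (rule linearI) (simp_all add: trace_def sum.distrib sum_distrib_left)
  moreover have "bounded_linear mat_of_sym2"
    by (rule bounded_linear_intro[where K = 1])
      (simp_all add: plus_sym2.rep_eq scaleR_sym2.rep_eq norm_mat_of_sym2)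
  ultimately show ?thesis
    using bounded_linear_compose[of trace mat_of_sym2] by (simp add: tr_sym2.rep_eq[abs_def])
qed

text \<open>A fourth-order tensor is identified with the linear map it induces on the symmetric
  matrices; continuity is automatic since \<open>sym2\<close> is finite-dimensional.\<close>

definition sym_tensors :: "(sym2 \<Rightarrow>\<^sub>L sym2) set"
  where "sym_tensors = {E. \<forall>x y. blinfun_apply E x \<bullet> y = x \<bullet> blinfun_apply E y}"

definition loewner_le :: "(sym2 \<Rightarrow>\<^sub>L sym2) \<Rightarrow> (sym2 \<Rightarrow>\<^sub>L sym2) \<Rightarrow> bool"  (infix "\<preceq>\<^sub>L" 50)
  where "E \<preceq>\<^sub>L F \<longleftrightarrow> (\<forall>e. 0 \<le> blinfun_apply (F - E) e \<bullet> e)"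

lift_definition iso_tensor :: "real \<Rightarrow> real \<Rightarrow> (sym2 \<Rightarrow>\<^sub>L sym2)" is
  "\<lambda>\<kappa> \<mu> e. (\<kappa> * tr_sym2 e) *\<^sub>R id_sym2 + (2 * \<mu>) *\<^sub>R (e - (1/2 * tr_sym2 e) *\<^sub>R id_sym2)"
  by (intro bounded_linear_add bounded_linear_sub bounded_linear_ident
      bounded_linear_compose[OF bounded_linear_scaleR_right]
      bounded_linear_compose[OF bounded_linear_scaleR_left]
      bounded_linear_compose[OF bounded_linear_mult_right bounded_linear_tr_sym2])

text \<open>In what follows \<open>\<kappa>m\<close>, \<open>\<mu>m\<close> are the moduli of the phase \<open>E\<^sup>-\<close> and \<open>\<kappa>p\<close>, \<open>\<mu>p\<close> those of
  \<open>E\<^sup>+\<close>.\<close>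

definition voigt_tensor :: "real \<Rightarrow> real \<Rightarrow> real \<Rightarrow> real \<Rightarrow> real \<Rightarrow> (sym2 \<Rightarrow>\<^sub>L sym2)"
  where "voigt_tensor \<kappa>m \<kappa>p \<mu>m \<mu>p v =
    (1 - v) *\<^sub>R iso_tensor \<kappa>m \<mu>m + v *\<^sub>R iso_tensor \<kappa>p \<mu>p"

definition voigt_set :: "real \<Rightarrow> real \<Rightarrow> real \<Rightarrow> real \<Rightarrow> real \<Rightarrow> (sym2 \<Rightarrow>\<^sub>L sym2) set"
  where "voigt_set \<kappa>m \<kappa>p \<mu>m \<mu>p v =
    {E \<in> sym_tensors. iso_tensor \<kappa>m \<mu>m \<preceq>\<^sub>L E \<and> E \<preceq>\<^sub>L voigt_tensor \<kappa>m \<kappa>p \<mu>m \<mu>p v}"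

text \<open>The last \<open>else\<close> branch is reached exactly when the first of the two inequalities holds and
  the second, \<open>v * s * \<Delta>\<mu> \<le> (\<kappa>p + \<mu>p - \<Delta>\<mu> * v) * t\<close>, fails. For \<open>0 < \<kappa>m < \<kappa>p\<close>,
  \<open>0 < \<mu>m < \<mu>p\<close> and \<open>0 \<le> v \<le> 1\<close> the two inequalities never fail simultaneously, so
  the order of the last two branches is irrelevant.\<close>

definition q_HS :: "real \<Rightarrow> real \<Rightarrow> real \<Rightarrow> real \<Rightarrow> sym2 \<Rightarrow> real \<Rightarrow> real"
  where "q_HS \<kappa>m \<kappa>p \<mu>m \<mu>p e v =
    (let \<Delta>\<kappa> = \<kappa>p - \<kappa>m; \<Delta>\<mu> = \<mu>p - \<mu>m;
         t = \<bar>tr_sym2 e\<bar>; s = sqrt ((tr_sym2 e)\<^sup>2 - 4 * det_sym2 e)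
     in if v * t * \<Delta>\<kappa> \<le> (\<kappa>p + \<mu>p - \<Delta>\<kappa> * v) * s \<and> v * s * \<Delta>\<mu> \<le> (\<kappa>p + \<mu>p - \<Delta>\<mu> * v) * t
        then v * (1 - v) * (\<Delta>\<kappa> * t - \<Delta>\<mu> * s)\<^sup>2 / (\<kappa>p + \<mu>p - (\<Delta>\<kappa> + \<Delta>\<mu>) * v)
        else if v * t * \<Delta>\<kappa> > (\<kappa>p + \<mu>p - \<Delta>\<kappa> * v) * s
        then (1 - v) * (v * t\<^sup>2 * \<Delta>\<kappa>\<^sup>2 / (\<kappa>p + \<mu>p - \<Delta>\<kappa> * v) - s\<^sup>2 * \<Delta>\<mu>)
        else (1 - v) * (v * s\<^sup>2 * \<Delta>\<mu>\<^sup>2 / (\<kappa>p + \<mu>p - \<Delta>\<mu> * v) - t\<^sup>2 * \<Delta>\<kappa>))"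

definition f_HS :: "real \<Rightarrow> real \<Rightarrow> real \<Rightarrow> real \<Rightarrow> sym2 \<Rightarrow> real \<Rightarrow> real"
  where "f_HS \<kappa>m \<kappa>p \<mu>m \<mu>p e v =
    blinfun_apply (voigt_tensor \<kappa>m \<kappa>p \<mu>m \<mu>p v) e \<bullet> e - q_HS \<kappa>m \<kappa>p \<mu>m \<mu>p e v"

definition hashin_shtrikman_set ::
    "real \<Rightarrow> real \<Rightarrow> real \<Rightarrow> real \<Rightarrow> real \<Rightarrow> (sym2 \<Rightarrow>\<^sub>L sym2) set"
  where "hashin_shtrikman_set \<kappa>m \<kappa>p \<mu>m \<mu>p v =
    {E \<in> sym_tensors. iso_tensor \<kappa>m \<mu>m \<preceq>\<^sub>L E \<and>
      (\<forall>e. blinfun_apply E e \<bullet> e \<le> f_HS \<kappa>m \<kappa>p \<mu>m \<mu>p e v)}"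

definition F_HS :: "real \<Rightarrow> real \<Rightarrow> real \<Rightarrow> real \<Rightarrow> (real \<times> (sym2 \<Rightarrow>\<^sub>L sym2)) set"
  where "F_HS \<kappa>m \<kappa>p \<mu>m \<mu>p =
    {(v, E) \<in> {0..1} \<times> sym_tensors. E \<in> hashin_shtrikman_set \<kappa>m \<kappa>p \<mu>m \<mu>p v}"

definition F_V :: "real \<Rightarrow> real \<Rightarrow> real \<Rightarrow> real \<Rightarrow> (real \<times> (sym2 \<Rightarrow>\<^sub>L sym2)) set"
  where "F_V \<kappa>m \<kappa>p \<mu>m \<mu>p =
    {(v, E) \<in> {0..1} \<times> sym_tensors. E \<in> voigt_set \<kappa>m \<kappa>p \<mu>m \<mu>p v}"

end

(* At v = 0 and v = 1 the correction q vanishes, so the Hashin-Shtrikman and Voigt fibres coincide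
   there. A Voigt pair with 0 < v <= 1 is the convex combination
   (v, E) = (1 - v) (0, E^-) + v (1, E^- + (E - E^-) / v) of pairs in these two fibres.
   Conversely q >= 0 puts F_HS into F_V, which is convex because its constraints are affine
   in (v, E) jointly. *)
theory Submission
  imports Defs
begin

text \<open>By symmetry the discriminant of the characteristic polynomial is a sum of two squares.
  It makes the \<open>s\<close> in \<open>q_HS\<close> a nonnegative square root; the library's
  \<open>sqrt\<close> is negative on negative arguments.\<close>

lemma discriminant_sym2_nonneg: "0 \<le> (tr_sym2 e)\<^sup>2 - 4 * det_sym2 e"
proof -
  have "transpose (mat_of_sym2 e) $ 2 $ 1 = mat_of_sym2 e $ 2 $ 1"
    using mat_of_sym2[of e] by simp
  then have off: "mat_of_sym2 e $ 1 $ 2 = mat_of_sym2 e $ 2 $ 1"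
    by (simp add: transpose_def)
  have "(tr_sym2 e)\<^sup>2 - 4 * det_sym2 e
      = (mat_of_sym2 e $ 1 $ 1 - mat_of_sym2 e $ 2 $ 2)\<^sup>2 + (2 * mat_of_sym2 e $ 2 $ 1)\<^sup>2"
    by (simp add: tr_sym2.rep_eq det_sym2.rep_eq trace_def sum_2 det_2 off power2_eq_square
        algebra_simps)
  then show ?thesis by simp
qed

lemma inner_id_sym2: "id_sym2 \<bullet> e = tr_sym2 e"
  by transfer (simp add: inner_vec_def trace_def sum_2 mat_def)

lemma inner_id_sym2_right: "e \<bullet> id_sym2 = tr_sym2 e"
  by (simp add: inner_commute[of e] inner_id_sym2)

text \<open>Since the trace is the inner product with \<open>id_sym2\<close>, the map taking
  \<open>e\<close> to its trace times \<open>id_sym2\<close> is a self-adjoint operator of rank one;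
  the rest is a multiple of the identity.\<close>

lemma iso_tensor_in_sym_tensors: "iso_tensor \<kappa> \<mu> \<in> sym_tensors"
  by (auto simp: sym_tensors_def iso_tensor.rep_eq inner_add_left inner_add_right inner_diff_left
      inner_diff_right inner_id_sym2 inner_id_sym2_right)

lemma sym_tensors_add: "E \<in> sym_tensors \<Longrightarrow> F \<in> sym_tensors \<Longrightarrow> E + F \<in> sym_tensors"
  by (simp add: sym_tensors_def plus_blinfun.rep_eq inner_add_left inner_add_right)

lemma sym_tensors_diff: "E \<in> sym_tensors \<Longrightarrow> F \<in> sym_tensors \<Longrightarrow> E - F \<in> sym_tensors"
  by (simp add: sym_tensors_def minus_blinfun.rep_eq inner_diff_left inner_diff_right)

lemma sym_tensors_scaleR: "E \<in> sym_tensors \<Longrightarrow> c *\<^sub>R E \<in> sym_tensors"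
  by (simp add: sym_tensors_def scaleR_blinfun.rep_eq)

lemma loewner_le_iff: "E \<preceq>\<^sub>L F \<longleftrightarrow> (\<forall>e. blinfun_apply E e \<bullet> e \<le> blinfun_apply F e \<bullet> e)"
  by (simp add: loewner_le_def minus_blinfun.rep_eq inner_diff_left)

lemma loewner_le_convex_combination:
  assumes "E \<preceq>\<^sub>L F" "E' \<preceq>\<^sub>L F'" "0 \<le> a" "0 \<le> b"
  shows "a *\<^sub>R E + b *\<^sub>R E' \<preceq>\<^sub>L a *\<^sub>R F + b *\<^sub>R F'"
  using assms
  by (auto simp: loewner_le_iff plus_blinfun.rep_eq scaleR_blinfun.rep_eq inner_add_left
      intro!: add_mono mult_left_mono)

lemma hashin_shtrikman_set_eq_voigt_set:
  assumes "\<And>e. q_HS \<kappa>m \<kappa>p \<mu>m \<mu>p e v = 0"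
  shows "hashin_shtrikman_set \<kappa>m \<kappa>p \<mu>m \<mu>p v = voigt_set \<kappa>m \<kappa>p \<mu>m \<mu>p v"
  by (simp add: hashin_shtrikman_set_def voigt_set_def f_HS_def assms loewner_le_iff)

lemma convex_F_V: "convex (F_V \<kappa>m \<kappa>p \<mu>m \<mu>p)"
proof (rule convexI)
  fix x y :: "real \<times> (sym2 \<Rightarrow>\<^sub>L sym2)" and a b :: real
  assume x: "x \<in> F_V \<kappa>m \<kappa>p \<mu>m \<mu>p" and y: "y \<in> F_V \<kappa>m \<kappa>p \<mu>m \<mu>p"
    and ab: "0 \<le> a" "0 \<le> b" "a + b = 1"
  obtain v E w F where xy: "x = (v, E)" "y = (w, F)" by (cases x, cases y)
  have vw: "v \<in> {0..1}" "w \<in> {0..1}" and sym: "E \<in> sym_tensors" "F \<in> sym_tensors"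
    and lower: "iso_tensor \<kappa>m \<mu>m \<preceq>\<^sub>L E" "iso_tensor \<kappa>m \<mu>m \<preceq>\<^sub>L F"
    and upper: "E \<preceq>\<^sub>L voigt_tensor \<kappa>m \<kappa>p \<mu>m \<mu>p v" "F \<preceq>\<^sub>L voigt_tensor \<kappa>m \<kappa>p \<mu>m \<mu>p w"
    using x y xy by (auto simp: F_V_def voigt_set_def)
  have b: "b = 1 - a" using ab by simp
  have "a *\<^sub>R v + b *\<^sub>R w \<in> {0..1}"
    using vw ab convexD[OF convex_real_interval(5)] by blast
  moreover have "a *\<^sub>R E + b *\<^sub>R F \<in> sym_tensors"
    using sym by (intro sym_tensors_add sym_tensors_scaleR)
  moreover have "iso_tensor \<kappa>m \<mu>m \<preceq>\<^sub>L a *\<^sub>R E + b *\<^sub>R F"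
    using loewner_le_convex_combination[OF lower ab(1,2)] ab(3)
    by (simp flip: scaleR_add_left)
  \<comment> \<open>\<open>voigt_tensor\<close> is affine, not linear, in the volume fraction, so
    this identity rests on \<open>a + b = 1\<close>, supplied through \<open>b\<close>.\<close>
  moreover have "a *\<^sub>R voigt_tensor \<kappa>m \<kappa>p \<mu>m \<mu>p v + b *\<^sub>R voigt_tensor \<kappa>m \<kappa>p \<mu>m \<mu>p w
      = voigt_tensor \<kappa>m \<kappa>p \<mu>m \<mu>p (a *\<^sub>R v + b *\<^sub>R w)"
    by (simp add: voigt_tensor_def b algebra_simps)
  then have "a *\<^sub>R E + b *\<^sub>R F \<preceq>\<^sub>L voigt_tensor \<kappa>m \<kappa>p \<mu>m \<mu>p (a *\<^sub>R v + b *\<^sub>R w)"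
    using loewner_le_convex_combination[OF upper ab(1,2)] by simp
  ultimately show "a *\<^sub>R x + b *\<^sub>R y \<in> F_V \<kappa>m \<kappa>p \<mu>m \<mu>p"
    by (simp add: xy F_V_def voigt_set_def)
qed

text \<open>This serves both outer branches of \<open>q_HS\<close>, which differ by exchanging
  \<open>t\<close> with \<open>s\<close> and the bulk with the shear moduli. The branch condition is
  squared and compared with the bound that \<open>v \<le> 1\<close> and
  \<open>\<beta> \<le> D\<close> give; then \<open>v\<close> and \<open>D\<close> are divided
  out.\<close>

lemma q_HS_outer_branch_nonneg:
  fixes v t s D \<alpha> \<beta> :: real
  assumes v: "0 \<le> v" "v \<le> 1" and s: "0 \<le> s" and \<beta>: "0 \<le> \<beta>"
    and D: "\<beta> \<le> D" "0 < D" and less: "D * s < v * t * \<alpha>"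
  shows "0 \<le> (1 - v) * (v * t\<^sup>2 * \<alpha>\<^sup>2 / D - s\<^sup>2 * \<beta>)"
proof -
  have "v * (s\<^sup>2 * \<beta> * D) \<le> (D * s)\<^sup>2"
  proof -
    have "v * (s\<^sup>2 * \<beta> * D) \<le> 1 * (s\<^sup>2 * D * D)"
      using v \<beta> D by (intro mult_mono mult_right_mono) (auto intro: mult_left_mono)
    then show ?thesis by (simp add: power2_eq_square mult_ac)
  qed
  also have "\<dots> \<le> (v * t * \<alpha>)\<^sup>2"
    using less D s by (intro power_mono) auto
  also have "\<dots> = v * (v * t\<^sup>2 * \<alpha>\<^sup>2)"
    by (simp add: power2_eq_square mult_ac)
  finally have *: "v * (s\<^sup>2 * \<beta> * D) \<le> v * (v * t\<^sup>2 * \<alpha>\<^sup>2)" .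
  \<comment> \<open>For \<open>v = 0\<close> the branch condition would read
    \<open>D * s < 0\<close>.\<close>
  have "v \<noteq> 0"
    using less D s by (auto simp: mult_less_0_iff)
  then have "s\<^sup>2 * \<beta> * D \<le> v * t\<^sup>2 * \<alpha>\<^sup>2"
    using * v by simp
  then have "s\<^sup>2 * \<beta> \<le> v * t\<^sup>2 * \<alpha>\<^sup>2 / D"
    using D by (simp add: pos_le_divide_eq)
  then show ?thesis using v by simp
qed

context
  fixes \<kappa>m \<kappa>p \<mu>m \<mu>p :: real
  assumes moduli: "0 < \<kappa>m" "\<kappa>m < \<kappa>p" "0 < \<mu>m" "\<mu>m < \<mu>p"
begin

text \<open>At \<open>v = 0\<close> both inequalities hold because \<open>s\<close> and
  \<open>t\<close> are nonnegative, so the first branch applies and its factor \<open>v\<close>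
  vanishes. The formulas of the outer branches would not vanish there.\<close>

lemma q_HS_0: "q_HS \<kappa>m \<kappa>p \<mu>m \<mu>p e 0 = 0"
  using moduli discriminant_sym2_nonneg[of e] by (simp add: q_HS_def)

text \<open>All three branches carry the factor \<open>1 - v\<close>.\<close>

lemma q_HS_1: "q_HS \<kappa>m \<kappa>p \<mu>m \<mu>p e 1 = 0"
  by (simp add: q_HS_def Let_def)

lemma q_HS_nonneg:
  assumes v: "0 \<le> v" "v \<le> 1"
  shows "0 \<le> q_HS \<kappa>m \<kappa>p \<mu>m \<mu>p e v"
proof -
  define t where "t = \<bar>tr_sym2 e\<bar>"
  define s where "s = sqrt ((tr_sym2 e)\<^sup>2 - 4 * det_sym2 e)"
  have ts: "0 \<le> t" "0 \<le> s"
    using discriminant_sym2_nonneg by (simp_all add: t_def s_def)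
  \<comment> \<open>These bound the three denominators below by \<open>\<kappa>m + \<mu>m\<close>,
    \<open>\<kappa>m + \<mu>p\<close> and \<open>\<kappa>p + \<mu>m\<close>. The last two dominate
    \<open>\<mu>p - \<mu>m\<close> and \<open>\<kappa>p - \<kappa>m\<close>, as the hypothesis
    \<open>\<beta> \<le> D\<close> requires.\<close>
  have \<kappa>: "(\<kappa>p - \<kappa>m) * v \<le> \<kappa>p - \<kappa>m" and \<mu>: "(\<mu>p - \<mu>m) * v \<le> \<mu>p - \<mu>m"
    using v moduli by (simp_all add: mult_left_le)
  have "0 \<le> v * (1 - v) * ((\<kappa>p - \<kappa>m) * t - (\<mu>p - \<mu>m) * s)\<^sup>2
      / (\<kappa>p + \<mu>p - ((\<kappa>p - \<kappa>m) + (\<mu>p - \<mu>m)) * v)"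
    using v \<kappa> \<mu> moduli by (intro divide_nonneg_nonneg mult_nonneg_nonneg)
      (simp_all only: distrib_right, auto)
  moreover have "0 \<le> (1 - v) * (v * t\<^sup>2 * (\<kappa>p - \<kappa>m)\<^sup>2 / (\<kappa>p + \<mu>p - (\<kappa>p - \<kappa>m) * v)
      - s\<^sup>2 * (\<mu>p - \<mu>m))"
    if "v * t * (\<kappa>p - \<kappa>m) > (\<kappa>p + \<mu>p - (\<kappa>p - \<kappa>m) * v) * s"
    using that \<kappa> moduli by (intro q_HS_outer_branch_nonneg v ts) linarith+
  moreover have "0 \<le> (1 - v) * (v * s\<^sup>2 * (\<mu>p - \<mu>m)\<^sup>2 / (\<kappa>p + \<mu>p - (\<mu>p - \<mu>m) * v)
      - t\<^sup>2 * (\<kappa>p - \<kappa>m))"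
    if "v * s * (\<mu>p - \<mu>m) > (\<kappa>p + \<mu>p - (\<mu>p - \<mu>m) * v) * t"
    using that \<mu> moduli by (intro q_HS_outer_branch_nonneg v ts) linarith+
  \<comment> \<open>In the last \<open>else\<close> branch the first inequality holds, so it is the
    second that fails; this is the guard of the third fact.\<close>
  ultimately show ?thesis
    unfolding q_HS_def Let_def t_def[symmetric] s_def[symmetric]
    by (simp add: not_le not_less split: if_split)
qed

lemma F_HS_subset_F_V: "F_HS \<kappa>m \<kappa>p \<mu>m \<mu>p \<subseteq> F_V \<kappa>m \<kappa>p \<mu>m \<mu>p"
proof clarify
  fix v E
  assume "(v, E) \<in> F_HS \<kappa>m \<kappa>p \<mu>m \<mu>p"
  then have v: "0 \<le> v" "v \<le> 1" and E: "E \<in> sym_tensors" "iso_tensor \<kappa>m \<mu>m \<preceq>\<^sub>L E"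
    and le: "blinfun_apply E e \<bullet> e \<le> f_HS \<kappa>m \<kappa>p \<mu>m \<mu>p e v" for e
    by (auto simp: F_HS_def hashin_shtrikman_set_def)
  have "blinfun_apply E e \<bullet> e \<le> blinfun_apply (voigt_tensor \<kappa>m \<kappa>p \<mu>m \<mu>p v) e \<bullet> e" for e
    using le[of e] q_HS_nonneg[OF v, of e] by (simp add: f_HS_def)
  then show "(v, E) \<in> F_V \<kappa>m \<kappa>p \<mu>m \<mu>p"
    using v E by (simp add: F_V_def voigt_set_def loewner_le_iff)
qed

lemma F_V_subset_hull: "F_V \<kappa>m \<kappa>p \<mu>m \<mu>p \<subseteq> convex hull F_HS \<kappa>m \<kappa>p \<mu>m \<mu>p"
proof clarify
  fix v E
  assume vE: "(v, E) \<in> F_V \<kappa>m \<kappa>p \<mu>m \<mu>p"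
  let ?Em = "iso_tensor \<kappa>m \<mu>m"
  have v: "0 \<le> v" "v \<le> 1" and sym: "E \<in> sym_tensors" and lower: "?Em \<preceq>\<^sub>L E"
    and upper: "E \<preceq>\<^sub>L voigt_tensor \<kappa>m \<kappa>p \<mu>m \<mu>p v"
    using vE by (auto simp: F_V_def voigt_set_def)
  note HS_0 = hashin_shtrikman_set_eq_voigt_set[of \<kappa>m \<kappa>p \<mu>m \<mu>p 0, OF q_HS_0]
  note HS_1 = hashin_shtrikman_set_eq_voigt_set[of \<kappa>m \<kappa>p \<mu>m \<mu>p 1, OF q_HS_1]
  show "(v, E) \<in> convex hull F_HS \<kappa>m \<kappa>p \<mu>m \<mu>p"
  proof (cases "v = 0")
    case True
    then have "(v, E) \<in> F_HS \<kappa>m \<kappa>p \<mu>m \<mu>p"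
      using vE HS_0 by (simp add: F_HS_def F_V_def)
    then show ?thesis by (rule hull_inc)
  next
    case False
    with v have pos: "0 < v" by simp
    \<comment> \<open>The line from \<open>(0, ?Em)\<close> through \<open>(v, E)\<close> meets the
      slice of volume fraction 1 in \<open>(1, F)\<close>.\<close>
    define F where "F = ?Em + (1 / v) *\<^sub>R (E - ?Em)"
    have F_apply: "blinfun_apply F e \<bullet> e
        = blinfun_apply ?Em e \<bullet> e + (blinfun_apply E e \<bullet> e - blinfun_apply ?Em e \<bullet> e) / v" for e
      by (simp add: F_def plus_blinfun.rep_eq minus_blinfun.rep_eq scaleR_blinfun.rep_eq
          inner_add_left inner_diff_left)
    have "F \<in> sym_tensors"
      unfolding F_def
      by (intro sym_tensors_add sym_tensors_scaleR sym_tensors_diff iso_tensor_in_sym_tensors sym)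
    moreover have "?Em \<preceq>\<^sub>L F"
      using lower pos by (simp add: loewner_le_iff F_apply)
    \<comment> \<open>The Voigt tensor at \<open>v\<close> exceeds E^- by \<open>v\<close> times
      (E^+ - E^-), so dividing the upper bound on \<open>E - ?Em\<close> by \<open>v\<close> leaves
      exactly E^+ as the bound on \<open>F\<close>.\<close>
    moreover have "F \<preceq>\<^sub>L voigt_tensor \<kappa>m \<kappa>p \<mu>m \<mu>p 1"
      using upper pos
      by (simp add: loewner_le_iff F_apply voigt_tensor_def plus_blinfun.rep_eq
          minus_blinfun.rep_eq scaleR_blinfun.rep_eq inner_add_left inner_diff_left field_simps)
    ultimately have one: "(1, F) \<in> F_HS \<kappa>m \<kappa>p \<mu>m \<mu>p"
      by (simp add: F_HS_def HS_1 voigt_set_def)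
    \<comment> \<open>At \<open>v = 0\<close> the Voigt tensor is \<open>?Em\<close> itself, so both
      Loewner bounds hold with equality.\<close>
    have zero: "(0, ?Em) \<in> F_HS \<kappa>m \<kappa>p \<mu>m \<mu>p"
      by (simp add: F_HS_def HS_0 voigt_set_def iso_tensor_in_sym_tensors loewner_le_iff
          voigt_tensor_def)
    have "(v, E) = (1 - v) *\<^sub>R (0, ?Em) + v *\<^sub>R (1, F)"
      using pos by (simp add: F_def algebra_simps)
    then show ?thesis
      using convexD[OF convex_convex_hull hull_inc[OF zero] hull_inc[OF one], of "1 - v" v] v
      by simp
  qed
qed

end

theorem lemma3p2:
  fixes \<kappa>m \<kappa>p \<mu>m \<mu>p :: real
  assumes "0 < \<kappa>m" and "\<kappa>m < \<kappa>p" and "0 < \<mu>m" and "\<mu>m < \<mu>p"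
  shows "convex hull (F_HS \<kappa>m \<kappa>p \<mu>m \<mu>p) = F_V \<kappa>m \<kappa>p \<mu>m \<mu>p"
proof
  show "convex hull (F_HS \<kappa>m \<kappa>p \<mu>m \<mu>p) \<subseteq> F_V \<kappa>m \<kappa>p \<mu>m \<mu>p"
    by (intro hull_minimal F_HS_subset_F_V[OF assms] convex_F_V)
  show "F_V \<kappa>m \<kappa>p \<mu>m \<mu>p \<subseteq> convex hull (F_HS \<kappa>m \<kappa>p \<mu>m \<mu>p)"
    by (rule F_V_subset_hull[OF assms])
qed

end
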